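(* Let $\mathcal{G}$ be a connected graph and let $\mathcal{T}$ be a spanning tree of $\mathcal{G}$. Consider $\mathcal{T}$ as a bipartite graph, and let $a$ and $b$ be the numbers of vertices in its two color classes. Then $$M(\mathcal{G})\ge a+b+\binom{a}{2}+\binom{b}{2}.$$
   Context: Graphs are finite, simple and undirected. For a graph $\mathcal{G}$ with $n$ vertices and adjacency matrix $A$, viewed over $\mathbb{F}_2$, let $C(\mathcal{G})\subseteq\mathbb{F}_2^{2n}$ be the binary linear code generated by the rows of $[I_n|A]$, where $I_n$ is the $n\times n$ identity matrix. The support of a vector is the set of positions of its nonzero entries. A nonzero codeword $c$ of a binary linear code $C$ is minimal if there is no nonzero codeword $c'\in C$ with $\operatorname{supp}(c')\subsetneq\operatorname{supp}(c)$. $M(\mathcal{G})$ denotes the number of minimal codewords of $C(\mathcal{G})$; it does not depend on the labeling of the vertices. *)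

theory Defs
  imports
    "Jordan_Normal_Form.VS_Connect"
    "Graph_Theory.Digraph_Component"
    "Graph_Theory.Pair_Digraph"
    "HOL-Library.Z2"
begin

text \<open>
  Finite simple undirected graphs are rendered by the locale \<open>pair_graph\<close>: a finite
  vertex set together with a symmetric irreflexive relation, so that an undirected edge is a pair
  of opposite arcs.
\<close>

section \<open>Spanning trees and color classes\<close>

text \<open>
  The constants \<open>tree\<close> and \<open>spanning_tree\<close> of Graph_Theory are about directed
  acyclicity and are unsuitable here: a pair of opposite arcs already counts as a directed cycle
  of length 2.  In a symmetric digraph without loops and parallel arcs, the cycles of length at
  least 3 are exactly the (oriented) cycles of the underlying undirected graph.  Connected graphs
  are nonempty, by the library's definition.
\<close>

definition undirected_tree :: "'a pair_pre_digraph \<Rightarrow> bool" where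
  "undirected_tree T \<longleftrightarrow>
     pair_graph T \<and> Digraph_Component.connected (with_proj T) \<and>
     \<not> (\<exists>p. pre_digraph.cycle (with_proj T) p \<and> 3 \<le> length p)"

definition undirected_spanning_tree :: "'a pair_pre_digraph \<Rightarrow> 'a pair_pre_digraph \<Rightarrow> bool" where
  "undirected_spanning_tree T G \<longleftrightarrow> undirected_tree T \<and> spanning (with_proj T) (with_proj G)"

definition color_classes :: "'a pair_pre_digraph \<Rightarrow> 'a set \<Rightarrow> 'a set \<Rightarrow> bool" where
  "color_classes G X Y \<longleftrightarrow>
     X \<union> Y = pverts G \<and> X \<inter> Y = {} \<and>
     (\<forall>(u, v) \<in> parcs G. (u \<in> X \<and> v \<in> Y) \<or> (u \<in> Y \<and> v \<in> X))"

section \<open>Minimal codewords of a binary linear code\<close>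

definition supp :: "'b::zero vec \<Rightarrow> nat set" where
  "supp c = {i. i < dim_vec c \<and> c $ i \<noteq> 0}"

definition minimal_codeword :: "bit vec set \<Rightarrow> bit vec \<Rightarrow> bool" where
  "minimal_codeword C c \<longleftrightarrow>
     c \<in> C \<and> c \<noteq> 0\<^sub>v (dim_vec c) \<and>
     \<not> (\<exists>c' \<in> C. c' \<noteq> 0\<^sub>v (dim_vec c') \<and> supp c' \<subset> supp c)"

section \<open>The code of a graph\<close>

text \<open>
  The list \<open>vs\<close> is a labeling of the vertices, that is, an enumeration without repetitions.
\<close>

definition vertex_labeling :: "'a pair_pre_digraph \<Rightarrow> 'a list \<Rightarrow> bool" where
  "vertex_labeling G vs \<longleftrightarrow> distinct vs \<and> set vs = pverts G"

definition adjacency_mat :: "'a pair_pre_digraph \<Rightarrow> 'a list \<Rightarrow> bit mat" where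
  "adjacency_mat G vs =
     mat (length vs) (length vs) (\<lambda>(i, j). if (vs ! i, vs ! j) \<in> parcs G then 1 else 0)"

text \<open>The matrix \<open>[I|A]\<close>; the two lower blocks have no rows.\<close>

definition generator_mat :: "'a pair_pre_digraph \<Rightarrow> 'a list \<Rightarrow> bit mat" where
  "generator_mat G vs =
     (let n = length vs in
      four_block_mat (1\<^sub>m n) (adjacency_mat G vs) (0\<^sub>m 0 n) (0\<^sub>m 0 n))"

definition graph_code :: "'a pair_pre_digraph \<Rightarrow> 'a list \<Rightarrow> bit vec set" where
  "graph_code G vs = vec_space.row_space (2 * length vs) (generator_mat G vs)"

definition num_minimal_codewords :: "'a pair_pre_digraph \<Rightarrow> 'a list \<Rightarrow> nat" where
  "num_minimal_codewords G vs = card {c. minimal_codeword (graph_code G vs) c}"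

end

theory Submission
  imports Defs
begin

text \<open>
  The codewords are the sums \<open>c\<^sub>S\<close> of the rows of \<open>[I|A]\<close> indexed by a vertex set
  \<open>S\<close>.  The support of \<open>c\<^sub>S\<close> is \<open>S\<close> in the left half and the set of vertices with an odd
  number of neighbours in \<open>S\<close> in the right half.  It is enough to find many sets \<open>S\<close> with
  \<open>c\<^sub>S\<close> minimal inside each color class, since nonempty subsets of different classes are distinct.

  On a color class \<open>X\<close> let \<open>R\<close> be the relation of having a common neighbour in \<open>G\<close>.  Paths
  of the spanning tree alternate between the classes, so \<open>R\<close> is connected on \<open>X\<close>
  (\<open>common_nbr_connected\<close>).  Join every two vertices
  \<open>u, v \<in> X\<close>, possibly equal, by a shortest \<open>R\<close>-path, and let \<open>S\<close> be its vertex set.  Then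
  \<open>c\<^sub>S\<close> is minimal (\<open>minimal_generator_induced_path\<close>): a proper nonempty subset \<open>S'\<close>
  separates two consecutive vertices of the path; a common neighbour \<open>y\<close> of the two is adjacent to
  no other vertex of the path, because the path is chordless for \<open>R\<close>; so \<open>y\<close> has one neighbour
  in \<open>S'\<close> and two in \<open>S\<close>, and the support of \<open>c\<^sub>S\<^sub>'\<close> is not contained in that of
  \<open>c\<^sub>S\<close>.  The pair \<open>{u, v}\<close> can be recovered from \<open>S\<close> as the set of ends of an induced path
  (\<open>path_ends_induced_path\<close>), so distinct pairs give distinct codewords.  There are
  \<open>|X| + (|X| choose 2)\<close> such pairs.
\<close>

section \<open>Induced paths\<close>

text \<open>
  The sequence \<open>f 0, \<dots>, f k\<close> is an induced path of the symmetric relation \<open>R\<close>.  Loops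
  \<open>(x, x) \<in> R\<close> are permitted and play no role.
\<close>

definition induced_path :: "'a rel \<Rightarrow> (nat \<Rightarrow> 'a) \<Rightarrow> nat \<Rightarrow> bool" where
  "induced_path R f k \<longleftrightarrow> inj_on f {..k} \<and> (\<forall>i<k. (f i, f (Suc i)) \<in> R) \<and>
     (\<forall>i\<le>k. \<forall>j\<le>k. (f i, f j) \<in> R \<longrightarrow> j \<le> Suc i)"

lemma relpow_walk_segment:
  assumes "\<And>i. i < k \<Longrightarrow> (f i, f (Suc i)) \<in> R" and "i + d \<le> k"
  shows "(f i, f (i + d)) \<in> R ^^ d"
  using assms(2)
proof (induction d)
  case (Suc d)
  then show ?case using assms(1)[of "i + d"] by auto
qed simp

text \<open>
  A shortest walk is an induced path, since a repeated vertex or a chord would give a shortcut.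
\<close>

lemma induced_path_exists:
  assumes "(u, v) \<in> R\<^sup>*"
  obtains f k where "induced_path R f k" "f 0 = u" "f k = v"
proof -
  obtain k where k: "(u, v) \<in> R ^^ k" and least: "\<And>m. (u, v) \<in> R ^^ m \<Longrightarrow> k \<le> m"
    using exists_least_iff[of "\<lambda>k. (u, v) \<in> R ^^ k"] rtrancl_imp_relpow[OF assms]
    by (auto simp: not_less[symmetric])
  obtain f where f: "f 0 = u" "f k = v" and step: "\<And>i. i < k \<Longrightarrow> (f i, f (Suc i)) \<in> R"
    using k unfolding relpow_fun_conv by blast
  have prefix: "(u, f i) \<in> R ^^ i" if "i \<le> k" for i
    using relpow_walk_segment[of k f R 0 i] step that f by simp
  have suffix: "(f j, v) \<in> R ^^ (k - j)" if "j \<le> k" for j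
    using relpow_walk_segment[of k f R j "k - j"] step that f by simp
  have "\<not> i < j" if "f i = f j" "i \<le> k" "j \<le> k" for i j
  proof
    assume "i < j"
    have "(u, v) \<in> R ^^ (i + (k - j))"
      using prefix[of i] suffix[of j] that by (subst relpow_add) auto
    then show False using least[of "i + (k - j)"] \<open>i < j\<close> that by linarith
  qed
  then have inj: "inj_on f {..k}" by (force intro!: inj_onI intro: antisym simp: not_less)
  have "j \<le> Suc i" if "(f i, f j) \<in> R" "i \<le> k" "j \<le> k" for i j
  proof -
    have "(u, f j) \<in> R ^^ Suc i"
      using prefix[of i] that by auto
    then have "(u, v) \<in> R ^^ (Suc i + (k - j))"
      using suffix[of j] that by (subst relpow_add) auto
    then show ?thesis using least[of "Suc i + (k - j)"] that by linarith
  qed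
  with inj step f that show ?thesis unfolding induced_path_def by blast
qed

text \<open>
  On an induced path, the ends are determined by the set of its vertices: they are the vertices
  of \<open>S\<close> with at most one neighbour in the subgraph that \<open>S\<close> induces.
\<close>

definition path_ends :: "'a rel \<Rightarrow> 'a set \<Rightarrow> 'a set" where
  "path_ends R S = {x \<in> S. card {y \<in> S. y \<noteq> x \<and> (x, y) \<in> R} \<le> 1}"

lemma path_ends_induced_path:
  assumes path: "induced_path R f k" and "sym R"
  shows "path_ends R (f ` {..k}) = {f 0, f k}"
proof -
  have inj: "inj_on f {..k}" and step: "\<And>i. i < k \<Longrightarrow> (f i, f (Suc i)) \<in> R"
    and chordless: "\<And>i j. \<lbrakk>i \<le> k; j \<le> k; (f i, f j) \<in> R\<rbrakk> \<Longrightarrow> j \<le> Suc i"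
    using path unfolding induced_path_def by auto
  let ?N = "\<lambda>i. {y \<in> f ` {..k}. y \<noteq> f i \<and> (f i, y) \<in> R}"
  have nbr: "j = Suc i \<or> i = Suc j" if "i \<le> k" "j \<le> k" "(f i, f j) \<in> R" "f i \<noteq> f j" for i j
    using chordless[of i j] chordless[of j i] that symD[OF \<open>sym R\<close>, of "f i" "f j"]
    by (cases "i = j") auto
  have fin: "finite (?N i)" for i by auto
  have "?N 0 \<subseteq> {f 1}" using nbr[of 0] by auto
  then have first: "card (?N 0) \<le> 1" using card_mono[of "{f 1}"] by force
  have "?N k \<subseteq> {f (k - 1)}" using nbr[of k] by fastforce
  then have last: "card (?N k) \<le> 1" using card_mono[of "{f (k - 1)}"] by force
  have inner: "\<not> card (?N i) \<le> 1" if "0 < i" "i < k" for i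
  proof -
    have ne: "f (i - 1) \<noteq> f i" "f (Suc i) \<noteq> f i" "f (i - 1) \<noteq> f (Suc i)"
      using inj_onD[OF inj, of "i - 1" i] inj_onD[OF inj, of "Suc i" i]
        inj_onD[OF inj, of "i - 1" "Suc i"] that by fastforce+
    have "{f (i - 1), f (Suc i)} \<subseteq> ?N i"
      using ne that step[of i] step[of "i - 1"] symD[OF \<open>sym R\<close>, of "f (i - 1)" "f i"] by auto
    then have "card {f (i - 1), f (Suc i)} \<le> card (?N i)" using fin by (rule card_mono[rotated])
    then show ?thesis using ne by simp
  qed
  show ?thesis
  proof (intro subset_antisym subsetI)
    fix x assume "x \<in> path_ends R (f ` {..k})"
    then obtain i where "i \<le> k" "x = f i" "card (?N i) \<le> 1" unfolding path_ends_def by auto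
    then show "x \<in> {f 0, f k}" using inner[of i] by (cases "i = 0 \<or> i = k") auto
  qed (use first last in \<open>auto simp: path_ends_def\<close>)
qed

section \<open>Vertex sets that generate minimal codewords\<close>

text \<open>The vertices with an odd number of neighbours in \<open>S\<close>.\<close>

definition odd_nbrs :: "'a rel \<Rightarrow> 'a set \<Rightarrow> 'a set" where
  "odd_nbrs E S = {w. odd (card {u \<in> S. (u, w) \<in> E})}"

text \<open>
  The sum of the rows of \<open>[I|A]\<close> indexed by \<open>S\<close> has support \<open>S\<close> in the left half and
  \<open>odd_nbrs E S\<close> in the right half.  This is minimality of that sum, stated for vertex sets.
\<close>

definition minimal_generator :: "'a rel \<Rightarrow> 'a set \<Rightarrow> bool" where
  "minimal_generator E S \<longleftrightarrow>
     S \<noteq> {} \<and> (\<forall>S'. S' \<noteq> {} \<and> S' \<subset> S \<longrightarrow> \<not> odd_nbrs E S' \<subseteq> odd_nbrs E S)"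

text \<open>
  The relation of having a common neighbour, restricted to \<open>X\<close>.  The common neighbour itself
  may lie anywhere, in \<open>X\<close> too: a color class of a spanning tree of \<open>G\<close> need not be independent
  in \<open>G\<close>.
\<close>

definition common_nbr :: "'a rel \<Rightarrow> 'a set \<Rightarrow> 'a rel" where
  "common_nbr E X = {(u, v). u \<in> X \<and> v \<in> X \<and> (\<exists>y. (u, y) \<in> E \<and> (v, y) \<in> E)}"

lemma sym_common_nbr: "sym (common_nbr E X)"
  by (auto simp: sym_def common_nbr_def)

text \<open>
  A common neighbour of two consecutive vertices of an induced path has no further neighbour on
  the path.  So it has one neighbour in every subset of the path that separates the two, and two
  neighbours on the whole path.
\<close>

lemma minimal_generator_induced_path:
  assumes path: "induced_path (common_nbr E X) f k" and "f ` {..k} \<subseteq> X"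
  shows "minimal_generator E (f ` {..k})"
  unfolding minimal_generator_def
proof (intro conjI allI impI)
  fix S' assume S': "S' \<noteq> {} \<and> S' \<subset> f ` {..k}"
  have inj: "inj_on f {..k}" and step: "\<And>i. i < k \<Longrightarrow> (f i, f (Suc i)) \<in> common_nbr E X"
    and chordless: "\<And>i j. \<lbrakk>i \<le> k; j \<le> k; (f i, f j) \<in> common_nbr E X\<rbrakk> \<Longrightarrow> j \<le> Suc i"
    using path unfolding induced_path_def by auto
  have "\<exists>i<k. \<not> (f i \<in> S' \<longleftrightarrow> f (Suc i) \<in> S')"
  proof (rule ccontr)
    assume "\<not> ?thesis"
    then have "f i \<in> S' \<longleftrightarrow> f 0 \<in> S'" if "i \<le> k" for i
      using that by (induction i) auto
    with S' show False by auto
  qed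
  then obtain i where i: "i < k" and sep: "\<not> (f i \<in> S' \<longleftrightarrow> f (Suc i) \<in> S')" by blast
  obtain y where y: "(f i, y) \<in> E" "(f (Suc i), y) \<in> E"
    using step[OF i] unfolding common_nbr_def by auto
  have only: "j = i \<or> j = Suc i" if "j \<le> k" "(f j, y) \<in> E" for j
  proof -
    have "(f i, f j) \<in> common_nbr E X" "(f j, f (Suc i)) \<in> common_nbr E X"
      using that y i assms(2) by (auto simp: common_nbr_def)
    then show ?thesis using chordless[of i j] chordless[of j "Suc i"] i that by auto
  qed
  have "{u \<in> f ` {..k}. (u, y) \<in> E} = {f i, f (Suc i)}"
    using only y i by auto
  moreover have "f i \<noteq> f (Suc i)" using inj_onD[OF inj, of i "Suc i"] i by auto
  ultimately have "y \<notin> odd_nbrs E (f ` {..k})" by (simp add: odd_nbrs_def)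
  moreover have "{u \<in> S'. (u, y) \<in> E} = (if f i \<in> S' then {f i} else {f (Suc i)})"
    using only y sep S' by auto
  then have "y \<in> odd_nbrs E S'" by (simp add: odd_nbrs_def)
  ultimately show "\<not> odd_nbrs E S' \<subseteq> odd_nbrs E (f ` {..k})" by blast
qed simp

lemma card_minimal_generators_ge:
  assumes "finite X" and conn: "\<And>u v. u \<in> X \<Longrightarrow> v \<in> X \<Longrightarrow> (u, v) \<in> (common_nbr E X)\<^sup>*"
  shows "card X + (card X choose 2) \<le> card {S. S \<subseteq> X \<and> minimal_generator E S}"
proof -
  let ?R = "common_nbr E X"
  \<comment> \<open>Unordered pairs of vertices; the pairs with equal components are the singletons.\<close>
  let ?P = "{p. p \<subseteq> X \<and> card p = 1} \<union> {p. p \<subseteq> X \<and> card p = 2}"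
  have "\<forall>p\<in>?P. \<exists>S. S \<subseteq> X \<and> minimal_generator E S \<and> path_ends ?R S = p"
  proof
    fix p assume "p \<in> ?P"
    obtain u v where p: "p = {u, v}" "u \<in> X" "v \<in> X"
      using \<open>p \<in> ?P\<close> by (auto simp: card_1_singleton_iff card_2_iff)
    obtain f k where path: "induced_path ?R f k" and f: "f 0 = u" "f k = v"
      using induced_path_exists[OF conn[OF p(2,3)]] .
    have "f i \<in> X" if "i \<le> k" for i
      using path p f that
      by (cases "i = k") (auto simp: induced_path_def common_nbr_def)
    then have "f ` {..k} \<subseteq> X" by auto
    then show "\<exists>S. S \<subseteq> X \<and> minimal_generator E S \<and> path_ends ?R S = p"
      using minimal_generator_induced_path[OF path] path_ends_induced_path[OF path sym_common_nbr]
        p f by blast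
  qed
  from bchoice[OF this] obtain S
    where S: "\<forall>p\<in>?P. S p \<subseteq> X \<and> minimal_generator E (S p) \<and> path_ends ?R (S p) = p" ..
  then have "inj_on S ?P" by (intro inj_on_inverseI[of _ "path_ends ?R"]) blast
  then have "card ?P \<le> card {S. S \<subseteq> X \<and> minimal_generator E S}"
    using S \<open>finite X\<close> by (intro card_inj_on_le[of S]) auto
  moreover have "card ?P = card X + (card X choose 2)"
    using \<open>finite X\<close> by (subst card_Un_disjoint) (auto simp: n_subsets)
  ultimately show ?thesis by simp
qed

section \<open>Codewords as sums of rows\<close>

text \<open>
  The sum of the rows of \<open>[I|A]\<close> that belong to the vertices in \<open>S\<close>, given by its entries.
\<close>

definition row_sum :: "'a rel \<Rightarrow> 'a list \<Rightarrow> 'a set \<Rightarrow> bit vec" where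
  "row_sum E vs S = vec (2 * length vs) (\<lambda>i. if i < length vs then of_bool (vs ! i \<in> S)
     else of_bool (vs ! (i - length vs) \<in> odd_nbrs E S))"

lemma bit_of_nat_eq: "(of_nat m :: bit) = of_bool (odd m)"
  by (cases "even m") (auto elim!: evenE oddE)

lemma generator_mat_transpose_mult:
  assumes "distinct vs" and y: "y \<in> carrier_vec (length vs)"
  shows "(generator_mat G vs)\<^sup>T *\<^sub>v y =
    row_sum (parcs G) vs {vs ! i | i. i < length vs \<and> y $ i = 1}"
    (is "_ = row_sum _ _ ?S")
proof (rule eq_vecI)
  let ?n = "length vs"
  let ?M = "generator_mat G vs"
  have dims: "dim_row ?M = ?n" "dim_col ?M = 2 * ?n"
    by (simp_all add: generator_mat_def Let_def adjacency_mat_def)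
  show "dim_vec (?M\<^sup>T *\<^sub>v y) = dim_vec (row_sum (parcs G) vs ?S)"
    by (simp add: dims row_sum_def)
  fix i assume "i < dim_vec (row_sum (parcs G) vs ?S)"
  then have i: "i < 2 * ?n" by (simp add: row_sum_def)
  have mult: "(?M\<^sup>T *\<^sub>v y) $ i = (\<Sum>j<?n. ?M $$ (j, i) * y $ j)"
    using i y dims by (simp add: scalar_prod_def atLeast0LessThan)
  have mem: "vs ! j \<in> ?S \<longleftrightarrow> y $ j = 1" if "j < ?n" for j
    using that \<open>distinct vs\<close> by (auto simp: nth_eq_iff_index_eq)
  show "(?M\<^sup>T *\<^sub>v y) $ i = row_sum (parcs G) vs ?S $ i"
  proof (cases "i < ?n")
    case True
    have "(?M\<^sup>T *\<^sub>v y) $ i = (\<Sum>j<?n. if j = i then y $ j else 0)"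
      unfolding mult using True
      by (intro sum.cong) (auto simp: generator_mat_def Let_def adjacency_mat_def)
    also have "\<dots> = of_bool (y $ i = 1)" using True by (cases "y $ i") auto
    finally show ?thesis using True i mem[of i] by (simp add: row_sum_def)
  next
    case False
    let ?w = "vs ! (i - ?n)"
    have "(?M\<^sup>T *\<^sub>v y) $ i = (\<Sum>j<?n. of_bool (y $ j = 1 \<and> (vs ! j, ?w) \<in> parcs G))"
      unfolding mult using False i
      by (intro sum.cong) (auto simp: generator_mat_def Let_def adjacency_mat_def)
    also have "\<dots> = of_nat (card {j. j < ?n \<and> y $ j = 1 \<and> (vs ! j, ?w) \<in> parcs G})"
      by (simp add: sum.If_cases of_bool_def Int_def)
    also have "card {j. j < ?n \<and> y $ j = 1 \<and> (vs ! j, ?w) \<in> parcs G} =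
        card {u \<in> ?S. (u, ?w) \<in> parcs G}"
      by (rule bij_betw_same_card[of "\<lambda>j. vs ! j"])
        (use \<open>distinct vs\<close> in \<open>auto simp: bij_betw_def inj_on_def nth_eq_iff_index_eq\<close>)
    finally show ?thesis using False i
      by (simp add: row_sum_def bit_of_nat_eq odd_nbrs_def)
  qed
qed

lemma graph_code_eq:
  assumes "distinct vs"
  shows "graph_code G vs = row_sum (parcs G) vs ` Pow (set vs)"
proof -
  let ?n = "length vs"
  have M: "generator_mat G vs \<in> carrier_mat ?n (2 * ?n)"
    by (intro carrier_matI) (simp_all add: generator_mat_def Let_def adjacency_mat_def)
  have "graph_code G vs = (\<lambda>y. (generator_mat G vs)\<^sup>T *\<^sub>v y) ` carrier_vec ?n"
    unfolding graph_code_def vec_space.row_space_eq[OF M] using M by auto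
  also have "\<dots> =
      (\<lambda>y :: bit vec. row_sum (parcs G) vs {vs ! i | i. i < ?n \<and> y $ i = 1}) ` carrier_vec ?n"
    by (intro image_cong refl) (rule generator_mat_transpose_mult[OF assms])
  also have "\<dots> = row_sum (parcs G) vs `
      (\<lambda>y :: bit vec. {vs ! i | i. i < ?n \<and> y $ i = 1}) ` carrier_vec ?n"
    by (simp add: image_image)
  also have "(\<lambda>y :: bit vec. {vs ! i | i. i < ?n \<and> y $ i = 1}) ` carrier_vec ?n = Pow (set vs)"
  proof (intro subset_antisym subsetI)
    fix S assume "S \<in> Pow (set vs)"
    then have "S = {vs ! i | i. i < ?n \<and> vs ! i \<in> S}"
      by (auto simp: in_set_conv_nth subset_iff)
    also have "\<dots> = {vs ! i | i. i < ?n \<and> vec ?n (\<lambda>i. of_bool (vs ! i \<in> S) :: bit) $ i = 1}"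
      by (intro Collect_cong ex_cong1) auto
    finally have "S = \<dots>" .
    then show "S \<in> (\<lambda>y :: bit vec. {vs ! i | i. i < ?n \<and> y $ i = 1}) ` carrier_vec ?n"
      by (rule image_eqI) simp
  qed auto
  finally show ?thesis .
qed

lemma supp_row_sum_subset_iff:
  assumes "S \<subseteq> set vs" "odd_nbrs E S \<subseteq> set vs"
  shows "supp (row_sum E vs S) \<subseteq> supp (row_sum E vs S') \<longleftrightarrow>
    S \<subseteq> S' \<and> odd_nbrs E S \<subseteq> odd_nbrs E S'"
proof
  assume sub: "supp (row_sum E vs S) \<subseteq> supp (row_sum E vs S')"
  let ?n = "length vs"
  have "vs ! i \<in> S'" if "i < ?n" "vs ! i \<in> S" for i
    using subsetD[OF sub, of i] that by (auto simp: supp_def row_sum_def)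
  moreover have "vs ! i \<in> odd_nbrs E S'" if "i < ?n" "vs ! i \<in> odd_nbrs E S" for i
    using subsetD[OF sub, of "?n + i"] that by (auto simp: supp_def row_sum_def)
  ultimately show "S \<subseteq> S' \<and> odd_nbrs E S \<subseteq> odd_nbrs E S'"
    using assms by (metis in_set_conv_nth subset_iff)
qed (auto simp: supp_def row_sum_def split: if_splits)

lemma minimal_codeword_row_sum:
  assumes "distinct vs" and E: "parcs G \<subseteq> set vs \<times> set vs"
    and "S \<subseteq> set vs" and min: "minimal_generator (parcs G) S"
  shows "minimal_codeword (graph_code G vs) (row_sum (parcs G) vs S)"
proof -
  let ?c = "row_sum (parcs G) vs"
  have odd: "odd_nbrs (parcs G) S' \<subseteq> set vs" for S'
  proof
    fix w assume "w \<in> odd_nbrs (parcs G) S'"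
    then have "{u \<in> S'. (u, w) \<in> parcs G} \<noteq> {}" unfolding odd_nbrs_def by force
    then show "w \<in> set vs" using E by auto
  qed
  have supp_zero: "supp c = {} \<longleftrightarrow> c = 0\<^sub>v (dim_vec c)" for c :: "bit vec"
    by (auto simp: supp_def vec_eq_iff)
  have empty: "supp (?c {}) = {}" by (auto simp: supp_def row_sum_def odd_nbrs_def)
  have "S \<noteq> {}" using min by (simp add: minimal_generator_def)
  then have "\<not> supp (?c S) \<subseteq> supp (?c {})"
    using supp_row_sum_subset_iff[OF assms(3) odd] by simp
  then have "?c S \<noteq> 0\<^sub>v (dim_vec (?c S))"
    using supp_zero by blast
  moreover have "\<not> supp c' \<subset> supp (?c S)"
    if c': "c' \<in> graph_code G vs" "c' \<noteq> 0\<^sub>v (dim_vec c')" for c'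
  proof
    assume sub: "supp c' \<subset> supp (?c S)"
    obtain S' where S': "S' \<subseteq> set vs" "c' = ?c S'"
      using c' graph_code_eq[OF \<open>distinct vs\<close>] by auto
    have "S' \<noteq> {}" using empty supp_zero c' S' by blast
    moreover have "S' \<subseteq> S" "odd_nbrs (parcs G) S' \<subseteq> odd_nbrs (parcs G) S"
      using sub supp_row_sum_subset_iff[OF S'(1) odd] S'(2) by auto
    moreover have "S' \<noteq> S" using sub S' by auto
    ultimately show False using min unfolding minimal_generator_def by blast
  qed
  moreover have "?c S \<in> graph_code G vs" using assms(3) graph_code_eq[OF \<open>distinct vs\<close>] by auto
  ultimately show ?thesis unfolding minimal_codeword_def by blast
qed

lemma inj_on_row_sum: "inj_on (row_sum E vs) (Pow (set vs))"
proof (rule inj_onI)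
  fix S S' assume S: "S \<in> Pow (set vs)" "S' \<in> Pow (set vs)" "row_sum E vs S = row_sum E vs S'"
  have "vs ! i \<in> S \<longleftrightarrow> vs ! i \<in> S'" if "i < length vs" for i
    using arg_cong[OF S(3), of "\<lambda>c. c $ i"] that by (simp add: row_sum_def of_bool_def split: if_splits)
  then have "x \<in> S \<longleftrightarrow> x \<in> S'" if "x \<in> set vs" for x
    using that by (auto simp: in_set_conv_nth)
  with S(1,2) show "S = S'" by blast
qed

lemma card_minimal_generators_le:
  assumes "distinct vs" and "parcs G \<subseteq> set vs \<times> set vs"
  shows "card {S. S \<subseteq> set vs \<and> minimal_generator (parcs G) S} \<le> num_minimal_codewords G vs"
  unfolding num_minimal_codewords_def
proof (rule card_inj_on_le)
  show "inj_on (row_sum (parcs G) vs) {S. S \<subseteq> set vs \<and> minimal_generator (parcs G) S}"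
    by (rule inj_on_subset[OF inj_on_row_sum]) auto
  have "{c. minimal_codeword (graph_code G vs) c} \<subseteq> graph_code G vs"
    by (auto simp: minimal_codeword_def)
  then show "finite {c. minimal_codeword (graph_code G vs) c}"
    by (rule finite_subset) (simp add: graph_code_eq[OF \<open>distinct vs\<close>])
qed (use minimal_codeword_row_sum[OF assms] in auto)

section \<open>Color classes of a connected bipartite graph\<close>

text \<open>
  A path between two vertices of one color class alternates between the classes, so that every
  second vertex of it gives a walk in the common neighbour relation.
\<close>

lemma common_nbr_connected:
  assumes "(u, w) \<in> F\<^sup>*" and "sym F" and "F \<subseteq> E"
    and bip: "F \<subseteq> X \<times> Y \<union> Y \<times> X" and "X \<inter> Y = {}" and "u \<in> X" and "w \<in> X"
  shows "(u, w) \<in> (common_nbr E X)\<^sup>*"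
proof -
  have "(w \<in> X \<longrightarrow> (u, w) \<in> (common_nbr E X)\<^sup>*) \<and>
      (w \<notin> X \<longrightarrow> (\<exists>x\<in>X. (u, x) \<in> (common_nbr E X)\<^sup>* \<and> (x, w) \<in> F))"
    using assms(1)
  proof (induction rule: rtrancl_induct)
    case (step y z)
    show ?case
    proof (cases "y \<in> X")
      case True
      then show ?thesis using step bip \<open>X \<inter> Y = {}\<close> by blast
    next
      case False
      then obtain x where x: "x \<in> X" "(u, x) \<in> (common_nbr E X)\<^sup>*" "(x, y) \<in> F"
        using step.IH by blast
      have "z \<in> X" using False step.hyps bip by blast
      then have "(x, z) \<in> common_nbr E X"
        using x step.hyps \<open>F \<subseteq> E\<close> symD[OF \<open>sym F\<close>] unfolding common_nbr_def by blast
      then show ?thesis using x \<open>z \<in> X\<close> by (auto intro: rtrancl_into_rtrancl)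
    qed
  qed (use \<open>u \<in> X\<close> in auto)
  with \<open>w \<in> X\<close> show ?thesis by blast
qed

theorem lemma3p10:
  fixes G T :: "'a pair_pre_digraph" and vs :: "'a list" and X Y :: "'a set"
  assumes "pair_graph G"
    and "Digraph_Component.connected (with_proj G)"
    and "undirected_spanning_tree T G"
    and "color_classes T X Y"
    and "a = card X" and "b = card Y"
    and "vertex_labeling G vs"
  shows "num_minimal_codewords G vs \<ge> a + b + (a choose 2) + (b choose 2)"
proof -
  have T: "pair_graph T" "Digraph_Component.connected (with_proj T)"
    and "spanning (with_proj T) (with_proj G)"
    using assms(3) by (auto simp: undirected_spanning_tree_def undirected_tree_def)
  then have sub: "parcs T \<subseteq> parcs G" and verts: "pverts T = pverts G"
    by (auto simp: spanning_def subgraph_def)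
  have sym: "sym (parcs T)"
    using pair_sym_digraph.pair_sym_arcs[of T] T(1)
    by (simp add: pair_graph_def pair_pseudo_graph_def symmetric_def)
  have conn: "(u, v) \<in> (parcs T)\<^sup>*" if "u \<in> pverts T" "v \<in> pverts T" for u v
  proof -
    have "u \<rightarrow>\<^sup>*\<^bsub>with_proj (mk_symmetric (with_proj T))\<^esub> v"
      using T(2) that
      by (simp add: Digraph_Component.connected_def strongly_connected_def mk_symmetric_def)
    then have "(u, v) \<in> (parcs (mk_symmetric (with_proj T)))\<^sup>*"
      by (auto dest: reachable_rtranclI)
    moreover have "parcs (mk_symmetric (with_proj T)) = parcs T"
      using sym by (auto simp: mk_symmetric_def sym_def)
    ultimately show ?thesis by simp
  qed
  have vs: "distinct vs" "set vs = pverts T"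
    using assms(7) verts by (auto simp: vertex_labeling_def)
  have E: "parcs G \<subseteq> set vs \<times> set vs"
    using pair_wf_digraph.in_arcsD1[of G] pair_wf_digraph.in_arcsD2[of G] assms(1) vs verts
    by (auto simp: pair_graph_def pair_pseudo_graph_def pair_sym_digraph_def)
  have XY: "X \<union> Y = set vs" "X \<inter> Y = {}" and bip: "parcs T \<subseteq> X \<times> Y \<union> Y \<times> X"
    using assms(4) vs by (auto simp: color_classes_def)
  have fin: "finite X" "finite Y" using XY(1) by (metis finite_Un finite_set)+
  let ?M = "\<lambda>Z. {S. S \<subseteq> Z \<and> minimal_generator (parcs G) S}"
  have "(u, v) \<in> (common_nbr (parcs G) X)\<^sup>*" if "u \<in> X" "v \<in> X" for u v
    by (rule common_nbr_connected[OF conn sym sub bip XY(2)]) (use that XY vs in auto)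
  then have X: "a + (a choose 2) \<le> card (?M X)"
    unfolding assms(5) by (rule card_minimal_generators_ge[OF fin(1)])
  have "(u, v) \<in> (common_nbr (parcs G) Y)\<^sup>*" if "u \<in> Y" "v \<in> Y" for u v
    by (rule common_nbr_connected[OF conn sym sub, of _ _ _ X]) (use that XY vs bip in auto)
  then have Y: "b + (b choose 2) \<le> card (?M Y)"
    unfolding assms(6) by (rule card_minimal_generators_ge[OF fin(2)])
  have "?M X \<inter> ?M Y = {}"
    using XY(2) by (auto simp: minimal_generator_def)
  then have "card (?M X) + card (?M Y) = card (?M X \<union> ?M Y)"
    using fin by (intro card_Un_disjoint[symmetric]) auto
  also have "\<dots> \<le> card (?M (set vs))"
    using XY(1) by (intro card_mono) auto
  also have "\<dots> \<le> num_minimal_codewords G vs"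
    by (rule card_minimal_generators_le[OF vs(1) E])
  finally show ?thesis using X Y by linarith
qed

end
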